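(* For every instance $(G=(V,E),K,D,\Pi)$, $$z_{\mathrm{LP_{R3}}}=z_{\mathrm{LP_{R2}}}.$$
   Context: An instance consists of: a finite undirected graph $G=(V,E)$ (parallel edges allowed), each edge $e=\{u,v\}\in E$ being a link between a pair of nodes; a finite set $K$ of wavelengths; a finite set $D$ of requests, each $d\in D$ having an origin $s_d\in V$ and a destination $t_d\in V$ (different requests may share the same pair); and a set $\Pi\subseteq E$ of links that may fail. For $e=\{u,v\}\in E$ let $\alpha_1(e)=(u,v)$ and $\alpha_2(e)=(v,u)$ be the two directed arcs associated with $e$ (arcs of different edges are different), $A=\{\alpha_1(e),\alpha_2(e):e\in E\}$, and let $A^+(v)$, $A^-(v)$ be the sets of arcs of $A$ leaving and entering $v\in V$. For $s,t\in V$ let $q_{st}$ be the number of requests $d\in D$ with $s_d=s$ and $t_d=t$. $\mathrm{LP_{R2}}$ is the linear program: minimize $\sum_{\kappa\in K}\sum_{e\in E}w^{\kappa,e}$ over $y^{\kappa,a}_{\tau,d}\in[0,1]$ ($\tau\in\Pi,d\in D,\kappa\in K,a\in A$) and $w^{\kappa,e}\in[0,1]$ ($\kappa\in K,e\in E$) subject to $\sum_{a\in A^+(s_d)}\sum_{\kappa\in K}y^{\kappa,a}_{\tau,d}=1$ and $\sum_{a\in A^-(s_d)}\sum_{\kappa\in K}y^{\kappa,a}_{\tau,d}=0$ for all $\tau\in\Pi,d\in D$; $\sum_{a\in A^-(v)}y^{\kappa,a}_{\tau,d}=\sum_{a\in A^+(v)}y^{\kappa,a}_{\tau,d}$ for all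 $\tau\in\Pi,d\in D,\kappa\in K,v\in V\setminus\{s_d,t_d\}$; $\sum_{d\in D}(y^{\kappa,\alpha_1(e)}_{\tau,d}+y^{\kappa,\alpha_2(e)}_{\tau,d})\le w^{\kappa,e}$ for all $\tau\in\Pi,\kappa\in K,e\in E$; $y^{\kappa,\alpha_1(\tau)}_{\tau,d}+y^{\kappa,\alpha_2(\tau)}_{\tau,d}=0$ for all $\tau\in\Pi,d\in D,\kappa\in K$. $\mathrm{LP_{R3}}$ is the linear program: minimize $\sum_{e\in E}\bar w^{e}$ over real variables $\bar w^e$ ($e\in E$) and $y^a_{\tau,s}$ ($\tau\in\Pi,s\in V,a\in A$) subject to $\sum_{a\in A^+(s)}y^a_{\tau,s}=\sum_{t\in V}q_{st}$ and $\sum_{a\in A^-(s)}y^a_{\tau,s}=0$ for all $\tau\in\Pi,s\in V$; $\sum_{a\in A^-(v)}y^a_{\tau,s}=\sum_{a\in A^+(v)}y^a_{\tau,s}+q_{sv}$ for all $\tau\in\Pi,s\in V,v\in V\setminus\{s\}$; $\sum_{s\in V}(y^{\alpha_1(e)}_{\tau,s}+y^{\alpha_2(e)}_{\tau,s})\le\bar w^e$ for all $\tau\in\Pi,e\in E$; $y^{\alpha_1(\tau)}_{\tau,s}+y^{\alpha_2(\tau)}_{\tau,s}=0$ for all $\tau\in\Pi,s\in V$; $0\le\bar w^e\le|K|$ for all $e\in E$; $0\le y^a_{\tau,s}\le\sum_{t\in V}q_{st}$ for all $\tau\in\Pi,s\in V,a\in A$. $z_M$ denotes the optimal objective value of model $M$,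 with the convention $z_M=+\infty$ if $M$ is infeasible. *)

theory Defs
  imports "HOL-Library.Extended_Real"
begin

text \<open>
  The graph is a multigraph: links are abstract names with two endpoints, so parallel links are
  distinct elements of \<open>links\<close>. The order of \<open>end1\<close> and \<open>end2\<close> only fixes which of the two arcs of
  a link is called \<open>\<alpha>\<^sub>1\<close>.
\<close>

record ('v, 'e, 'k, 'd) network =
  nodes :: "'v set"
  links :: "'e set"
  end1 :: "'e \<Rightarrow> 'v"
  end2 :: "'e \<Rightarrow> 'v"
  wavelengths :: "'k set"
  requests :: "'d set"
  origin :: "'d \<Rightarrow> 'v"
  destination :: "'d \<Rightarrow> 'v"
  failing :: "'e set"

text \<open>
  Self-loops (\<open>end1 e = end2 e\<close>) are not excluded; loopless graphs are a special case.
  Requests with equal origin and destination are not excluded either.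
\<close>

definition valid_instance :: "('v, 'e, 'k, 'd) network \<Rightarrow> bool" where
  "valid_instance N \<longleftrightarrow>
     finite (nodes N) \<and> finite (links N) \<and> finite (wavelengths N) \<and> finite (requests N) \<and>
     (\<forall>e\<in>links N. end1 N e \<in> nodes N \<and> end2 N e \<in> nodes N) \<and>
     (\<forall>d\<in>requests N. origin N d \<in> nodes N \<and> destination N d \<in> nodes N) \<and>
     failing N \<subseteq> links N"

text \<open>
  Arcs are tagged with their link rather than being pairs of nodes, because arcs of different
  (parallel) links must be different.
\<close>

datatype 'e arc = Alpha1 'e | Alpha2 'e

fun arc_tail :: "('v, 'e, 'k, 'd) network \<Rightarrow> 'e arc \<Rightarrow> 'v" where
  "arc_tail N (Alpha1 e) = end1 N e"
| "arc_tail N (Alpha2 e) = end2 N e"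

fun arc_head :: "('v, 'e, 'k, 'd) network \<Rightarrow> 'e arc \<Rightarrow> 'v" where
  "arc_head N (Alpha1 e) = end2 N e"
| "arc_head N (Alpha2 e) = end1 N e"

definition arcs :: "('v, 'e, 'k, 'd) network \<Rightarrow> 'e arc set" where
  "arcs N = Alpha1 ` links N \<union> Alpha2 ` links N"

definition out_arcs :: "('v, 'e, 'k, 'd) network \<Rightarrow> 'v \<Rightarrow> 'e arc set" where
  "out_arcs N v = {a \<in> arcs N. arc_tail N a = v}"

definition in_arcs :: "('v, 'e, 'k, 'd) network \<Rightarrow> 'v \<Rightarrow> 'e arc set" where
  "in_arcs N v = {a \<in> arcs N. arc_head N a = v}"

definition demand :: "('v, 'e, 'k, 'd) network \<Rightarrow> 'v \<Rightarrow> 'v \<Rightarrow> real" where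
  "demand N s t = real (card {d \<in> requests N. origin N d = s \<and> destination N d = t})"

text \<open>
  Both programs use total functions as families of variables: \<open>y \<tau> d \<kappa> a\<close> stands for
  \<open>y\<close> with superscripts \<open>\<kappa>, a\<close> and subscripts \<open>\<tau>, d\<close>. Values outside the index sets occur neither
  in the constraints nor in the objectives.
\<close>

definition feasible_LP_R2 ::
  "('v, 'e, 'k, 'd) network \<Rightarrow> ('e \<Rightarrow> 'd \<Rightarrow> 'k \<Rightarrow> 'e arc \<Rightarrow> real) \<Rightarrow> ('k \<Rightarrow> 'e \<Rightarrow> real) \<Rightarrow> bool" where
  "feasible_LP_R2 N y w \<longleftrightarrow>
     (\<forall>\<tau>\<in>failing N. \<forall>d\<in>requests N.
        (\<Sum>a\<in>out_arcs N (origin N d). \<Sum>\<kappa>\<in>wavelengths N. y \<tau> d \<kappa> a) = 1 \<and>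
        (\<Sum>a\<in>in_arcs N (origin N d). \<Sum>\<kappa>\<in>wavelengths N. y \<tau> d \<kappa> a) = 0) \<and>
     (\<forall>\<tau>\<in>failing N. \<forall>d\<in>requests N. \<forall>\<kappa>\<in>wavelengths N.
        \<forall>v\<in>nodes N - {origin N d, destination N d}.
        (\<Sum>a\<in>in_arcs N v. y \<tau> d \<kappa> a) = (\<Sum>a\<in>out_arcs N v. y \<tau> d \<kappa> a)) \<and>
     (\<forall>\<tau>\<in>failing N. \<forall>\<kappa>\<in>wavelengths N. \<forall>e\<in>links N.
        (\<Sum>d\<in>requests N. y \<tau> d \<kappa> (Alpha1 e) + y \<tau> d \<kappa> (Alpha2 e)) \<le> w \<kappa> e) \<and>
     (\<forall>\<tau>\<in>failing N. \<forall>d\<in>requests N. \<forall>\<kappa>\<in>wavelengths N.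
        y \<tau> d \<kappa> (Alpha1 \<tau>) + y \<tau> d \<kappa> (Alpha2 \<tau>) = 0) \<and>
     (\<forall>\<tau>\<in>failing N. \<forall>d\<in>requests N. \<forall>\<kappa>\<in>wavelengths N. \<forall>a\<in>arcs N.
        0 \<le> y \<tau> d \<kappa> a \<and> y \<tau> d \<kappa> a \<le> 1) \<and>
     (\<forall>\<kappa>\<in>wavelengths N. \<forall>e\<in>links N. 0 \<le> w \<kappa> e \<and> w \<kappa> e \<le> 1)"

definition objective_LP_R2 :: "('v, 'e, 'k, 'd) network \<Rightarrow> ('k \<Rightarrow> 'e \<Rightarrow> real) \<Rightarrow> real" where
  "objective_LP_R2 N w = (\<Sum>\<kappa>\<in>wavelengths N. \<Sum>e\<in>links N. w \<kappa> e)"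

definition feasible_LP_R3 ::
  "('v, 'e, 'k, 'd) network \<Rightarrow> ('e \<Rightarrow> 'v \<Rightarrow> 'e arc \<Rightarrow> real) \<Rightarrow> ('e \<Rightarrow> real) \<Rightarrow> bool" where
  "feasible_LP_R3 N y w \<longleftrightarrow>
     (\<forall>\<tau>\<in>failing N. \<forall>s\<in>nodes N.
        (\<Sum>a\<in>out_arcs N s. y \<tau> s a) = (\<Sum>t\<in>nodes N. demand N s t) \<and>
        (\<Sum>a\<in>in_arcs N s. y \<tau> s a) = 0) \<and>
     (\<forall>\<tau>\<in>failing N. \<forall>s\<in>nodes N. \<forall>v\<in>nodes N - {s}.
        (\<Sum>a\<in>in_arcs N v. y \<tau> s a) = (\<Sum>a\<in>out_arcs N v. y \<tau> s a) + demand N s v) \<and>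
     (\<forall>\<tau>\<in>failing N. \<forall>e\<in>links N.
        (\<Sum>s\<in>nodes N. y \<tau> s (Alpha1 e) + y \<tau> s (Alpha2 e)) \<le> w e) \<and>
     (\<forall>\<tau>\<in>failing N. \<forall>s\<in>nodes N. y \<tau> s (Alpha1 \<tau>) + y \<tau> s (Alpha2 \<tau>) = 0) \<and>
     (\<forall>e\<in>links N. 0 \<le> w e \<and> w e \<le> real (card (wavelengths N))) \<and>
     (\<forall>\<tau>\<in>failing N. \<forall>s\<in>nodes N. \<forall>a\<in>arcs N.
        0 \<le> y \<tau> s a \<and> y \<tau> s a \<le> (\<Sum>t\<in>nodes N. demand N s t))"

definition objective_LP_R3 :: "('v, 'e, 'k, 'd) network \<Rightarrow> ('e \<Rightarrow> real) \<Rightarrow> real" where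
  "objective_LP_R3 N w = (\<Sum>e\<in>links N. w e)"

text \<open>
  Optimal values live in \<^typ>\<open>ereal\<close>, where the infimum of the empty set is \<open>\<infinity>\<close>, the convention for
  infeasible programs. A feasible program has bounded variables, hence attains its infimum.
\<close>

definition z_LP_R2 :: "('v, 'e, 'k, 'd) network \<Rightarrow> ereal" where
  "z_LP_R2 N = Inf {ereal (objective_LP_R2 N w) | y w. feasible_LP_R2 N y w}"

definition z_LP_R3 :: "('v, 'e, 'k, 'd) network \<Rightarrow> ereal" where
  "z_LP_R3 N = Inf {ereal (objective_LP_R3 N w) | y w. feasible_LP_R3 N y w}"

end

theory Submission
  imports Defs
begin

text \<open>
  Both programs have the same objective values as a program over one unit flow per failure and
  request, without wavelengths. A unit flow is spread evenly over the wavelengths to solve the first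
  program, and the flows of all requests with a common origin are added to solve the second.
  Conversely, forgetting the wavelengths, or taking the flow of one origin, gives a flow from which
  unit flows are extracted by peeling off trails from the origin to the destinations. A trail uses
  each arc at most once, so an extracted unit flow is at most 1 on every arc, even where circulations
  make the original flow larger.
\<close>

section \<open>Flows and their excess in a finite directed multigraph\<close>

locale finite_digraph =
  fixes V :: "'v set" and A :: "'a set" and tail head :: "'a \<Rightarrow> 'v"
  assumes finite_V: "finite V" and finite_A: "finite A"
    and tail_in: "a \<in> A \<Longrightarrow> tail a \<in> V" and head_in: "a \<in> A \<Longrightarrow> head a \<in> V"
begin

definition inflow :: "('a \<Rightarrow> real) \<Rightarrow> 'v \<Rightarrow> real" where
  "inflow f v = (\<Sum>a | a \<in> A \<and> head a = v. f a)"

definition outflow :: "('a \<Rightarrow> real) \<Rightarrow> 'v \<Rightarrow> real" where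
  "outflow f v = (\<Sum>a | a \<in> A \<and> tail a = v. f a)"

definition excess :: "('a \<Rightarrow> real) \<Rightarrow> 'v \<Rightarrow> real" where
  "excess f v = inflow f v - outflow f v"

lemma inflow_sum: "inflow (\<lambda>a. \<Sum>i\<in>I. f i a) v = (\<Sum>i\<in>I. inflow (f i) v)"
  unfolding inflow_def by (rule sum.swap)

lemma outflow_sum: "outflow (\<lambda>a. \<Sum>i\<in>I. f i a) v = (\<Sum>i\<in>I. outflow (f i) v)"
  unfolding outflow_def by (rule sum.swap)

lemma excess_sum: "excess (\<lambda>a. \<Sum>i\<in>I. f i a) v = (\<Sum>i\<in>I. excess (f i) v)"
  by (simp add: excess_def inflow_sum outflow_sum sum_subtractf)

lemma excess_add: "excess (\<lambda>a. f a + g a) v = excess f v + excess g v"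
  by (simp add: excess_def inflow_def outflow_def sum.distrib)

lemma excess_diff: "excess (\<lambda>a. f a - g a) v = excess f v - excess g v"
  by (simp add: excess_def inflow_def outflow_def sum_subtractf)

lemma excess_cmult: "excess (\<lambda>a. c * f a) v = c * excess f v"
  by (simp add: excess_def inflow_def outflow_def sum_distrib_left right_diff_distrib)

lemma excess_cong: "(\<And>a. a \<in> A \<Longrightarrow> f a = g a) \<Longrightarrow> excess f v = excess g v"
  unfolding excess_def inflow_def outflow_def by (intro arg_cong2[of _ _ _ _ minus] sum.cong) auto

lemma inflow_mono: "(\<And>a. a \<in> A \<Longrightarrow> f a \<le> g a) \<Longrightarrow> inflow f v \<le> inflow g v"
  unfolding inflow_def by (rule sum_mono) auto

lemma inflow_nonneg: "(\<And>a. a \<in> A \<Longrightarrow> 0 \<le> f a) \<Longrightarrow> 0 \<le> inflow f v"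
  unfolding inflow_def by (rule sum_nonneg) auto

text \<open>Exchanging the summations counts every arc with head in \<open>S\<close> positively and
  every arc with tail in \<open>S\<close> negatively, so arcs inside \<open>S\<close> cancel. It is
  applied to all of \<open>V\<close> and to the nodes from which a sink can be reached.\<close>

lemma sum_excess:
  assumes "S \<subseteq> V"
  shows "(\<Sum>v\<in>S. excess f v) = (\<Sum>a | a \<in> A \<and> head a \<in> S. f a) - (\<Sum>a | a \<in> A \<and> tail a \<in> S. f a)"
proof -
  have fS: "finite S" using assms finite_V finite_subset by blast
  have *: "(\<Sum>v\<in>S. \<Sum>a | a \<in> A \<and> h a = v. f a) = (\<Sum>a | a \<in> A \<and> h a \<in> S. f a)" for h :: "'a \<Rightarrow> 'v"
  proof -
    have "(\<Sum>v\<in>S. \<Sum>a | a \<in> {a \<in> A. h a \<in> S} \<and> h a = v. f a) = (\<Sum>a | a \<in> A \<and> h a \<in> S. f a)"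
      by (rule sum.group) (use fS finite_A in auto)
    moreover have "{a. a \<in> {a \<in> A. h a \<in> S} \<and> h a = v} = {a. a \<in> A \<and> h a = v}" if "v \<in> S" for v
      using that by auto
    ultimately show ?thesis by simp
  qed
  show ?thesis by (simp add: excess_def inflow_def outflow_def sum_subtractf *)
qed

lemma sum_excess_V: "(\<Sum>v\<in>V. excess f v) = 0"
proof -
  have "{a. a \<in> A \<and> head a \<in> V} = A" "{a. a \<in> A \<and> tail a \<in> V} = A"
    using head_in tail_in by auto
  then show ?thesis using sum_excess[of V f] by simp
qed

section \<open>Walks, trails and the flow along a trail\<close>

text \<open>Walks are lists of arcs because nodes alone do not tell parallel arcs apart. That the
  arcs lie in \<open>A\<close> is left to separate hypotheses.\<close>

fun walk :: "'v \<Rightarrow> 'a list \<Rightarrow> 'v \<Rightarrow> bool" where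
  "walk u [] v \<longleftrightarrow> u = v"
| "walk u (a # xs) v \<longleftrightarrow> tail a = u \<and> walk (head a) xs v"

lemma walk_append: "walk u (xs @ ys) w \<longleftrightarrow> (\<exists>v. walk u xs v \<and> walk v ys w)"
  by (induction xs arbitrary: u) auto

text \<open>Between two occurrences of an arc \<open>y\<close> lies a closed walk based at
  \<open>head y\<close>, which can be cut out together with one of the occurrences. Repeated arcs
  are removed but nodes may still repeat: what matters later is that each arc carries the routed
  amount at most once.\<close>

lemma walk_shorten:
  assumes "walk u xs v"
  obtains ys where "walk u ys v" "distinct ys" "set ys \<subseteq> set xs"
proof -
  have "\<exists>ys. walk u ys v \<and> distinct ys \<and> set ys \<subseteq> set xs" using assms
  proof (induction xs rule: length_induct)
    case (1 xs)
    show ?case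
    proof (cases "distinct xs")
      case False
      then obtain as bs cs y where xs: "xs = as @ [y] @ bs @ [y] @ cs"
        using not_distinct_decomp by blast
      have "walk u (as @ [y] @ cs) v" using "1.prems" by (auto simp: xs walk_append)
      moreover have "length (as @ [y] @ cs) < length xs" by (simp add: xs)
      ultimately obtain ys where "walk u ys v" "distinct ys" "set ys \<subseteq> set (as @ [y] @ cs)"
        using "1.IH" by blast
      then show ?thesis by (intro exI[of _ ys]) (auto simp: xs)
    qed (use "1.prems" in blast)
  qed
  then show ?thesis using that by blast
qed

lemma excess_single:
  assumes "b \<in> A"
  shows "excess (\<lambda>a. of_bool (a = b)) v = of_bool (v = head b) - of_bool (v = tail b)"
proof -
  have *: "(\<Sum>a | a \<in> A \<and> h a = v. of_bool (a = b)) = (of_bool (v = h b) :: real)" for h :: "'a \<Rightarrow> 'v"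
  proof -
    have "(\<Sum>a | a \<in> A \<and> h a = v. of_bool (a = b)) = (\<Sum>a | a \<in> A \<and> h a = v. if a = b then 1 else (0::real))"
      by (rule sum.cong) auto
    then show ?thesis using assms finite_A by (auto simp: sum.delta')
  qed
  show ?thesis by (simp add: excess_def inflow_def outflow_def *)
qed

text \<open>Since the arcs are distinct, the indicator of the trail is the sum of the indicators of
  its arcs. Their excesses telescope, each arc cancelling at its head what the next one takes
  there.\<close>

lemma excess_trail:
  assumes "walk u xs w" "distinct xs" "set xs \<subseteq> A"
  shows "excess (\<lambda>a. of_bool (a \<in> set xs)) v = of_bool (v = w) - of_bool (v = u)"
  using assms
proof (induction xs arbitrary: u)
  case Nil
  then show ?case by (simp add: excess_def inflow_def outflow_def)
next
  case (Cons b xs)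
  have "excess (\<lambda>a. of_bool (a \<in> set (b # xs))) v
      = excess (\<lambda>a. of_bool (a = b) + of_bool (a \<in> set xs)) v"
    by (rule excess_cong) (use Cons.prems in auto)
  also have "\<dots> = of_bool (v = w) - of_bool (v = u)"
    using Cons by (auto simp: excess_add excess_single)
  finally show ?case .
qed

text \<open>
  Otherwise no flow would enter the set of nodes from which \<open>t\<close> can be reached along arcs carrying
  flow, although the total excess of that set is positive.
\<close>

lemma positive_trail:
  assumes f: "\<And>a. a \<in> A \<Longrightarrow> 0 \<le> f a"
    and ex: "\<And>v. v \<in> V - {s} \<Longrightarrow> 0 \<le> excess f v"
    and t: "t \<in> V" "0 < excess f t"
  obtains xs where "walk s xs t" "distinct xs" "set xs \<subseteq> {a \<in> A. 0 < f a}"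
proof -
  define S where "S = {v \<in> V. \<exists>xs. walk v xs t \<and> set xs \<subseteq> {a \<in> A. 0 < f a}}"
  have S: "S \<subseteq> V" by (auto simp: S_def)
  have "t \<in> S" unfolding S_def using t by (auto intro!: exI[of _ "[]"])
  have closed: "tail a \<in> S" if a: "a \<in> A" "0 < f a" "head a \<in> S" for a
  proof -
    obtain xs where "walk (head a) xs t" "set xs \<subseteq> {a \<in> A. 0 < f a}"
      using a by (auto simp: S_def)
    then show ?thesis unfolding S_def using a tail_in by (auto intro!: exI[of _ "a # xs"])
  qed
  have "s \<in> S"
  proof (rule ccontr)
    assume "s \<notin> S"
    have "(\<Sum>a | a \<in> A \<and> head a \<in> S. f a) \<le> (\<Sum>a | a \<in> A \<and> tail a \<in> S. f a)"
    proof -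
      have "(\<Sum>a | a \<in> A \<and> head a \<in> S. f a) = (\<Sum>a | a \<in> A \<and> head a \<in> S \<and> 0 < f a. f a)"
        by (rule sum.mono_neutral_right) (use finite_A f in \<open>auto simp: less_le\<close>)
      also have "\<dots> \<le> (\<Sum>a | a \<in> A \<and> tail a \<in> S. f a)"
        by (rule sum_mono2) (use finite_A f closed in auto)
      finally show ?thesis .
    qed
    then have "(\<Sum>v\<in>S. excess f v) \<le> 0" using sum_excess[OF S] by simp
    moreover have "0 < (\<Sum>v\<in>S. excess f v)"
    proof (rule sum_pos2[where i = t])
      show "finite S" using S finite_V by (rule finite_subset)
    qed (use S \<open>s \<notin> S\<close> \<open>t \<in> S\<close> t ex in auto)
    ultimately show False by simp
  qed
  then obtain xs where xs: "walk s xs t" "set xs \<subseteq> {a \<in> A. 0 < f a}" by (auto simp: S_def)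
  obtain ys where "walk s ys t" "distinct ys" "set ys \<subseteq> set xs"
    using walk_shorten[OF xs(1)] .
  then show ?thesis using that[of ys] xs(2) by simp
qed

section \<open>Extracting flows for single requests from a given flow\<close>

text \<open>Trails from \<open>s\<close> to \<open>t\<close> are peeled off one at a time. Each
  round either completes the amount \<open>l\<close> or empties an arc, so the number of arcs with
  positive flow is the induction measure. The bound by \<open>l\<close> on each arc does not come
  from \<open>f\<close>: a trail adds at most its own amount to any arc, and the amounts of all
  trails add up to \<open>l\<close>.\<close>

lemma extract_flow:
  assumes "\<And>a. a \<in> A \<Longrightarrow> 0 \<le> f a"
    and "\<And>v. v \<in> V - {s} \<Longrightarrow> 0 \<le> excess f v"
    and "t \<in> V" "t \<noteq> s" "0 \<le> l" "l \<le> excess f t"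
  shows "\<exists>g. (\<forall>a\<in>A. 0 \<le> g a \<and> g a \<le> f a \<and> g a \<le> l) \<and>
             (\<forall>v. excess g v = l * (of_bool (v = t) - of_bool (v = s)))"
  using assms
proof (induction "card {a \<in> A. 0 < f a}" arbitrary: f l rule: less_induct)
  case less
  note f = less.prems(1) and ex = less.prems(2) and t = less.prems(3,4)
  show ?case
  proof (cases "l = 0")
    case True
    then show ?thesis
      using f by (intro exI[of _ "\<lambda>_. 0"]) (simp add: excess_def inflow_def outflow_def)
  next
    case False
    then have "0 < excess f t" using less.prems by simp
    then obtain xs where xs: "walk s xs t" "distinct xs" "set xs \<subseteq> {a \<in> A. 0 < f a}"
      using positive_trail[of f s t] f ex t by blast
    have "xs \<noteq> []" using xs(1) t by auto
    define c :: "'a \<Rightarrow> real" where "c a = of_bool (a \<in> set xs)" for a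
    define m where "m = Min (f ` set xs)"
    \<comment> \<open>The amount sent along the trail is limited by what is still required and by
      the bottleneck arc.\<close>
    define \<epsilon> where "\<epsilon> = min l m"
    have mle: "m \<le> f a" if "a \<in> set xs" for a using that by (simp add: m_def)
    have "m \<in> f ` set xs" unfolding m_def using \<open>xs \<noteq> []\<close> by (intro Min_in) auto
    then obtain b where b: "b \<in> set xs" "f b = m" by auto
    have "0 < m" using b xs by auto
    then have \<epsilon>: "0 < \<epsilon>" "\<epsilon> \<le> l" "\<epsilon> \<le> m" using False less.prems(5) by (auto simp: \<epsilon>_def)
    have exc: "excess c v = of_bool (v = t) - of_bool (v = s)" for v
      unfolding c_def by (rule excess_trail[OF xs(1,2)]) (use xs(3) in auto)
    have c01: "0 \<le> c a" "c a \<le> 1" for a by (auto simp: c_def)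
    have cf: "\<epsilon> * c a \<le> f a" if "a \<in> A" for a
      using that f mle[of a] \<epsilon> by (cases "a \<in> set xs") (auto simp: c_def)
    define f' where "f' = (\<lambda>a. f a - \<epsilon> * c a)"
    have f'0: "0 \<le> f' a" if "a \<in> A" for a using cf that by (simp add: f'_def)
    have exf': "excess f' v = excess f v - \<epsilon> * (of_bool (v = t) - of_bool (v = s))" for v
      by (simp add: f'_def excess_diff excess_cmult exc)
    \<comment> \<open>The rest \<open>l - \<epsilon>\<close> is taken from \<open>f'\<close>. If
      nothing is left, the zero flow serves; otherwise the bottleneck arc \<open>b\<close> has
      become empty and the induction hypothesis applies.\<close>
    have "\<exists>g. (\<forall>a\<in>A. 0 \<le> g a \<and> g a \<le> f' a \<and> g a \<le> l - \<epsilon>) \<and>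
             (\<forall>v. excess g v = (l - \<epsilon>) * (of_bool (v = t) - of_bool (v = s)))"
    proof (cases "\<epsilon> = l")
      case True
      then show ?thesis
        using f'0 by (intro exI[of _ "\<lambda>_. 0"]) (simp add: excess_def inflow_def outflow_def)
    next
      case False
      then have "\<epsilon> = m" by (auto simp: \<epsilon>_def min_def)
      then have "f' b = 0" using b by (simp add: f'_def c_def)
      have "{a \<in> A. 0 < f' a} \<subseteq> {a \<in> A. 0 < f a}"
      proof -
        have "f' a \<le> f a" for a using \<epsilon> c01(1)[of a] by (simp add: f'_def)
        then show ?thesis by (auto intro: less_le_trans)
      qed
      moreover have "b \<in> {a \<in> A. 0 < f a}" using b xs by auto
      moreover have "b \<notin> {a \<in> A. 0 < f' a}" using \<open>f' b = 0\<close> by simp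
      ultimately have "{a \<in> A. 0 < f' a} \<subset> {a \<in> A. 0 < f a}" by blast
      then have card: "card {a \<in> A. 0 < f' a} < card {a \<in> A. 0 < f a}"
        using finite_A by (intro psubset_card_mono) auto
      show ?thesis
      proof (rule less.hyps[OF card f'0])
        \<comment> \<open>Away from \<open>s\<close>, peeling the trail changes the excess only at
          \<open>t\<close>, where it drops by \<open>\<epsilon>\<close>, at most the available
          \<open>l\<close>.\<close>
        show "0 \<le> excess f' v" if "v \<in> V - {s}" for v
          using that ex[OF that] less.prems(6) \<epsilon> by (auto simp: exf')
      qed (use t less.prems(6) \<epsilon> in \<open>auto simp: exf'\<close>)
    qed
    then obtain g where g: "\<forall>a\<in>A. 0 \<le> g a \<and> g a \<le> f' a \<and> g a \<le> l - \<epsilon>"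
      "\<And>v. excess g v = (l - \<epsilon>) * (of_bool (v = t) - of_bool (v = s))" by blast
    have "0 \<le> \<epsilon> * c a \<and> \<epsilon> * c a \<le> \<epsilon>" for a
      using \<epsilon> c01[of a] by (simp add: mult_left_le)
    then have "\<forall>a\<in>A. 0 \<le> \<epsilon> * c a + g a \<and> \<epsilon> * c a + g a \<le> f a \<and> \<epsilon> * c a + g a \<le> l"
      using g(1) by (auto simp: f'_def intro: add_nonneg_nonneg dest!: bspec) (smt (verit))+
    moreover have "excess (\<lambda>a. \<epsilon> * c a + g a) v = l * (of_bool (v = t) - of_bool (v = s))" for v
      by (simp add: excess_add excess_cmult exc g(2) algebra_simps)
    ultimately show ?thesis by (intro exI[of _ "\<lambda>a. \<epsilon> * c a + g a"]) blast
  qed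
qed

text \<open>One unit flow is extracted per element of \<open>D\<close> and subtracted. The sum of
  indicators counts equal destinations with multiplicity, so the subtraction removes exactly one
  term from the required excess and leaves enough for the remaining elements.\<close>

lemma decompose_flow:
  assumes "finite D"
    and "\<And>d. d \<in> D \<Longrightarrow> dest d \<in> V - {s}"
    and "\<And>a. a \<in> A \<Longrightarrow> 0 \<le> f a"
    and "\<And>v. v \<in> V - {s} \<Longrightarrow> (\<Sum>d\<in>D. of_bool (v = dest d)) \<le> excess f v"
  shows "\<exists>g. (\<forall>d\<in>D. \<forall>a\<in>A. 0 \<le> g d a \<and> g d a \<le> 1) \<and>
             (\<forall>a\<in>A. (\<Sum>d\<in>D. g d a) \<le> f a) \<and>
             (\<forall>d\<in>D. \<forall>v. excess (g d) v = of_bool (v = dest d) - of_bool (v = s))"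
  using assms
proof (induction D arbitrary: f rule: finite_induct)
  case empty
  then show ?case by simp
next
  case (insert x D)
  have ex: "(\<Sum>d\<in>D. of_bool (v = dest d)) + of_bool (v = dest x) \<le> excess f v"
    if "v \<in> V - {s}" for v
    using insert.prems(3)[OF that] insert.hyps by (simp add: add.commute del: sum_of_bool_eq)
  have x: "dest x \<in> V" "dest x \<noteq> s" using insert.prems(1) by auto
  have "1 \<le> excess f (dest x)"
    by (rule order_trans[OF _ ex[of "dest x"]]) (use x in \<open>auto intro: sum_nonneg\<close>)
  moreover have "0 \<le> excess f v" if "v \<in> V - {s}" for v
    by (rule order_trans[OF _ ex[OF that]]) (intro add_nonneg_nonneg sum_nonneg, auto)
  ultimately obtain g0 where g0: "\<forall>a\<in>A. 0 \<le> g0 a \<and> g0 a \<le> f a \<and> g0 a \<le> 1"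
    "\<And>v. excess g0 v = of_bool (v = dest x) - of_bool (v = s)"
    using extract_flow[of f s "dest x" 1] insert.prems(2) x by auto
  have "\<exists>g. (\<forall>d\<in>D. \<forall>a\<in>A. 0 \<le> g d a \<and> g d a \<le> 1) \<and>
             (\<forall>a\<in>A. (\<Sum>d\<in>D. g d a) \<le> f a - g0 a) \<and>
             (\<forall>d\<in>D. \<forall>v. excess (g d) v = of_bool (v = dest d) - of_bool (v = s))"
  proof (rule insert.IH)
    show "(\<Sum>d\<in>D. of_bool (v = dest d)) \<le> excess (\<lambda>a. f a - g0 a) v" if "v \<in> V - {s}" for v
      using ex[OF that] that by (simp add: excess_diff g0(2))
  qed (use insert.prems(1) g0 in auto)
  then obtain g where g: "\<forall>d\<in>D. \<forall>a\<in>A. 0 \<le> g d a \<and> g d a \<le> 1"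
    "\<forall>a\<in>A. (\<Sum>d\<in>D. g d a) \<le> f a - g0 a"
    "\<forall>d\<in>D. \<forall>v. excess (g d) v = of_bool (v = dest d) - of_bool (v = s)" by blast
  have "(\<Sum>d\<in>D. (g(x := g0)) d a) = (\<Sum>d\<in>D. g d a)" for a
    by (rule sum.cong) (use insert.hyps in auto)
  then show ?case
    using g g0 insert.hyps by (intro exI[of _ "g(x := g0)"]) (auto simp: algebra_simps)
qed

end

section \<open>Unit flows in a network and the program without wavelengths\<close>

locale valid_network =
  fixes N :: "('v, 'e, 'k, 'd) network"
  assumes valid: "valid_instance N"
begin

sublocale finite_digraph "nodes N" "arcs N" "arc_tail N" "arc_head N"
  by unfold_locales (use valid in \<open>auto simp: valid_instance_def arcs_def\<close>)

lemma finites: "finite (nodes N)" "finite (links N)" "finite (wavelengths N)" "finite (requests N)"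
  and origin_in: "d \<in> requests N \<Longrightarrow> origin N d \<in> nodes N"
  and destination_in: "d \<in> requests N \<Longrightarrow> destination N d \<in> nodes N"
  and failing_links: "\<tau> \<in> failing N \<Longrightarrow> \<tau> \<in> links N"
  using valid by (auto simp: valid_instance_def)

lemma arcs_links: "Alpha1 e \<in> arcs N \<longleftrightarrow> e \<in> links N" "Alpha2 e \<in> arcs N \<longleftrightarrow> e \<in> links N"
  by (auto simp: arcs_def)

lemma sum_in_arcs: "(\<Sum>a\<in>in_arcs N v. f a) = inflow f v"
  and sum_out_arcs: "(\<Sum>a\<in>out_arcs N v. f a) = outflow f v"
  by (simp_all add: in_arcs_def out_arcs_def inflow_def outflow_def)

definition requests_from :: "'v \<Rightarrow> 'd set" where
  "requests_from s = {d \<in> requests N. origin N d = s}"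

lemma finite_requests_from: "finite (requests_from s)"
  using finites by (simp add: requests_from_def)

text \<open>In this form demands match both the hypothesis of \<open>decompose_flow\<close> and the
  excess of a sum of unit flows.\<close>

lemma demand_sum: "demand N s t = (\<Sum>d\<in>requests_from s. of_bool (t = destination N d))"
proof -
  have "{d \<in> requests N. origin N d = s \<and> destination N d = t}
      = requests_from s \<inter> {d. t = destination N d}"
    by (auto simp: requests_from_def)
  then show ?thesis by (simp only: demand_def sum_of_bool_eq finite_requests_from)
qed

lemma total_demand: "(\<Sum>t\<in>nodes N. demand N s t) = real (card (requests_from s))"
proof -
  have "(\<Sum>t\<in>nodes N. demand N s t)
      = (\<Sum>d\<in>requests_from s. \<Sum>t\<in>nodes N. of_bool (t = destination N d))"
    unfolding demand_sum by (rule sum.swap)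
  also have "\<dots> = (\<Sum>d\<in>requests_from s. 1)"
  proof (rule sum.cong)
    fix d assume "d \<in> requests_from s"
    then have "nodes N \<inter> {t. t = destination N d} = {destination N d}"
      using destination_in by (auto simp: requests_from_def)
    then show "(\<Sum>t\<in>nodes N. of_bool (t = destination N d)) = (1::real)"
      using finites by simp
  qed simp
  finally show ?thesis by simp
qed

lemma sum_requests: "(\<Sum>s\<in>nodes N. \<Sum>d\<in>requests_from s. f d) = (\<Sum>d\<in>requests N. f d)"
  unfolding requests_from_def by (rule sum.group) (use finites origin_in in auto)

text \<open>The inflow at \<open>s\<close> is fixed separately because the excess alone would admit
  a circulation through \<open>s\<close>. Requiring \<open>s \<noteq> t\<close> loses nothing: as
  soon as some link may fail, a request with equal ends makes both linear programs
  infeasible.\<close>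

definition unit_flow :: "'v \<Rightarrow> 'v \<Rightarrow> ('e arc \<Rightarrow> real) \<Rightarrow> bool" where
  "unit_flow s t f \<longleftrightarrow> s \<noteq> t \<and> inflow f s = 0 \<and> (\<forall>a\<in>arcs N. 0 \<le> f a \<and> f a \<le> 1) \<and>
     (\<forall>v\<in>nodes N. excess f v = of_bool (v = t) - of_bool (v = s))"

text \<open>The inflow of \<open>g\<close> at \<open>s\<close> is squeezed between 0 and that of
  \<open>f\<close>, so an extracted flow inherits the absence of flow into its origin.\<close>

lemma unit_flow_below:
  assumes "inflow f s = 0" "\<forall>a\<in>arcs N. 0 \<le> g a \<and> g a \<le> f a \<and> g a \<le> 1" "s \<noteq> t"
    and "\<forall>v. excess g v = of_bool (v = t) - of_bool (v = s)"
  shows "unit_flow s t g"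
proof -
  have "inflow g s \<le> 0" using inflow_mono[of g f s] assms by auto
  moreover have "0 \<le> inflow g s" using assms by (intro inflow_nonneg) auto
  ultimately show ?thesis using assms by (auto simp: unit_flow_def)
qed

definition feasible_flows :: "('e \<Rightarrow> 'd \<Rightarrow> 'e arc \<Rightarrow> real) \<Rightarrow> ('e \<Rightarrow> real) \<Rightarrow> bool" where
  "feasible_flows h w \<longleftrightarrow>
     (\<forall>\<tau>\<in>failing N. \<forall>d\<in>requests N. unit_flow (origin N d) (destination N d) (h \<tau> d) \<and>
        h \<tau> d (Alpha1 \<tau>) = 0 \<and> h \<tau> d (Alpha2 \<tau>) = 0) \<and>
     (\<forall>\<tau>\<in>failing N. \<forall>e\<in>links N. (\<Sum>d\<in>requests N. h \<tau> d (Alpha1 e) + h \<tau> d (Alpha2 e)) \<le> w e) \<and>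
     (\<forall>e\<in>links N. 0 \<le> w e \<and> w e \<le> real (card (wavelengths N)))"

section \<open>Between \<open>feasible_LP_R2\<close> and the program without wavelengths\<close>

text \<open>The sum \<open>f\<close> over the wavelengths has the right balances but may exceed 1 on
  an arc through circulations on several wavelengths. Replacing it by an extracted unit flow below
  it restores the bound, and the capacity and failure constraints survive since flow only
  decreases.\<close>

lemma flows_of_LP_R2:
  assumes R2: "feasible_LP_R2 N y w"
  shows "\<exists>h. feasible_flows h (\<lambda>e. \<Sum>\<kappa>\<in>wavelengths N. w \<kappa> e)"
proof -
  define f where "f \<tau> d a = (\<Sum>\<kappa>\<in>wavelengths N. y \<tau> d \<kappa> a)" for \<tau> d a
  have "\<exists>g. unit_flow (origin N d) (destination N d) g \<and> (\<forall>a\<in>arcs N. 0 \<le> g a \<and> g a \<le> f \<tau> d a)"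
    if \<tau>: "\<tau> \<in> failing N" and d: "d \<in> requests N" for \<tau> d
  proof -
    let ?s = "origin N d" and ?t = "destination N d"
    have s: "outflow (f \<tau> d) ?s = 1" "inflow (f \<tau> d) ?s = 0"
      using R2 \<tau> d unfolding feasible_LP_R2_def f_def by (auto simp flip: sum_in_arcs sum_out_arcs)
    have "excess (y \<tau> d \<kappa>) v = 0" if "v \<in> nodes N - {?s, ?t}" "\<kappa> \<in> wavelengths N" for v \<kappa>
      using R2 \<tau> d that unfolding feasible_LP_R2_def excess_def
      by (simp flip: sum_in_arcs sum_out_arcs)
    then have mid: "excess (f \<tau> d) v = 0" if "v \<in> nodes N - {?s, ?t}" for v
      using that by (simp add: f_def[abs_def] excess_sum)
    have "excess (f \<tau> d) ?s = -1" using s by (simp add: excess_def)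
    \<comment> \<open>The program imposes no balance at the destination. It follows from the total
      excess being 0: the origin contributes -1 and intermediate nodes nothing.\<close>
    have "(\<Sum>v\<in>nodes N. excess (f \<tau> d) v) = (\<Sum>v\<in>{?s, ?t}. excess (f \<tau> d) v)"
      by (rule sum.mono_neutral_right) (use finites origin_in destination_in d mid in auto)
    then have sum: "(\<Sum>v\<in>{?s, ?t}. excess (f \<tau> d) v) = 0" by (simp add: sum_excess_V)
    \<comment> \<open>With equal ends the set \<open>{?s, ?t}\<close> would be a singleton and its
      total excess -1 instead of 0.\<close>
    have st: "?s \<noteq> ?t"
    proof
      assume "?s = ?t"
      then show False using sum s by (simp add: excess_def)
    qed
    then have t: "excess (f \<tau> d) ?t = 1" using sum s by (simp add: excess_def)
    have f0: "0 \<le> f \<tau> d a" if "a \<in> arcs N" for a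
      unfolding f_def using R2 \<tau> d that by (intro sum_nonneg) (auto simp: feasible_LP_R2_def)
    have "0 \<le> excess (f \<tau> d) v" if "v \<in> nodes N - {?s}" for v
      using mid[of v] t that by (cases "v = ?t") auto
    then obtain g where "\<forall>a\<in>arcs N. 0 \<le> g a \<and> g a \<le> f \<tau> d a \<and> g a \<le> 1"
      "\<forall>v. excess g v = of_bool (v = ?t) - of_bool (v = ?s)"
      using extract_flow[of "f \<tau> d" ?s ?t 1] f0 destination_in[OF d] st t by auto
    then show ?thesis using unit_flow_below[OF s(2)] st by blast
  qed
  then have "\<forall>\<tau>\<in>failing N. \<forall>d\<in>requests N. \<exists>g. unit_flow (origin N d) (destination N d) g \<and>
      (\<forall>a\<in>arcs N. 0 \<le> g a \<and> g a \<le> f \<tau> d a)" by blast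
  then obtain h where h: "\<And>\<tau> d. \<tau> \<in> failing N \<Longrightarrow> d \<in> requests N \<Longrightarrow>
      unit_flow (origin N d) (destination N d) (h \<tau> d) \<and>
      (\<forall>a\<in>arcs N. 0 \<le> h \<tau> d a \<and> h \<tau> d a \<le> f \<tau> d a)"
    by metis
  have "h \<tau> d (Alpha1 \<tau>) = 0 \<and> h \<tau> d (Alpha2 \<tau>) = 0"
    if \<tau>: "\<tau> \<in> failing N" and d: "d \<in> requests N" for \<tau> d
  proof -
    have "f \<tau> d (Alpha1 \<tau>) + f \<tau> d (Alpha2 \<tau>) = 0"
      using R2 \<tau> d by (simp add: f_def feasible_LP_R2_def flip: sum.distrib)
    moreover have "0 \<le> h \<tau> d (Alpha1 \<tau>)" "h \<tau> d (Alpha1 \<tau>) \<le> f \<tau> d (Alpha1 \<tau>)"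
      "0 \<le> h \<tau> d (Alpha2 \<tau>)" "h \<tau> d (Alpha2 \<tau>) \<le> f \<tau> d (Alpha2 \<tau>)"
      using h[OF \<tau> d] arcs_links failing_links[OF \<tau>] by auto
    ultimately show ?thesis by linarith
  qed
  moreover have "(\<Sum>d\<in>requests N. h \<tau> d (Alpha1 e) + h \<tau> d (Alpha2 e)) \<le> (\<Sum>\<kappa>\<in>wavelengths N. w \<kappa> e)"
    if \<tau>: "\<tau> \<in> failing N" and e: "e \<in> links N" for \<tau> e
  proof -
    have "(\<Sum>d\<in>requests N. h \<tau> d (Alpha1 e) + h \<tau> d (Alpha2 e))
        \<le> (\<Sum>d\<in>requests N. f \<tau> d (Alpha1 e) + f \<tau> d (Alpha2 e))"
      using h[OF \<tau>] arcs_links e by (intro sum_mono add_mono) auto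
    also have "\<dots> = (\<Sum>\<kappa>\<in>wavelengths N. \<Sum>d\<in>requests N. y \<tau> d \<kappa> (Alpha1 e) + y \<tau> d \<kappa> (Alpha2 e))"
      unfolding f_def sum.distrib[symmetric] by (rule sum.swap)
    also have "\<dots> \<le> (\<Sum>\<kappa>\<in>wavelengths N. w \<kappa> e)"
      using R2 \<tau> e by (intro sum_mono) (auto simp: feasible_LP_R2_def)
    finally show ?thesis .
  qed
  moreover have "0 \<le> (\<Sum>\<kappa>\<in>wavelengths N. w \<kappa> e)"
    "(\<Sum>\<kappa>\<in>wavelengths N. w \<kappa> e) \<le> real (card (wavelengths N))" if e: "e \<in> links N" for e
    using R2 e sum_bounded_above[of "wavelengths N" "\<lambda>\<kappa>. w \<kappa> e" 1]
    by (auto simp: feasible_LP_R2_def intro!: sum_nonneg)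
  ultimately show ?thesis using h unfolding feasible_flows_def by (intro exI[of _ h]) auto
qed

lemma LP_R2_of_flows:
  assumes F: "feasible_flows h w"
  shows "\<exists>y w'. feasible_LP_R2 N y w' \<and> objective_LP_R2 N w' = objective_LP_R3 N w"
proof -
  define k where "k = real (card (wavelengths N))"
  define y where "y \<tau> d \<kappa> a = h \<tau> d a / k" for \<tau> :: 'e and d :: 'd and \<kappa> :: 'k and a
  define w' where "w' \<kappa> e = w e / k" for \<kappa> :: 'k and e
  have w: "0 \<le> w e" "w e \<le> k" if "e \<in> links N" for e
    using F that by (auto simp: feasible_flows_def k_def)
  have k: "0 < k" if "\<kappa> \<in> wavelengths N" for \<kappa>
    using that finites by (auto simp: k_def card_gt_0_iff)
  \<comment> \<open>Without wavelengths every capacity is 0, so all flow vanishes, contradicting the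
    excess -1 at an origin. Hence \<open>k = 0\<close> is possible only if there is no failing link
    or no request, and then no flow constraint has to be met.\<close>
  have k0: "k \<noteq> 0" if \<tau>: "\<tau> \<in> failing N" and d: "d \<in> requests N" for \<tau> d
  proof
    assume "k = 0"
    have "h \<tau> d a = 0" if a: "a \<in> arcs N" for a
    proof -
      obtain e where e: "e \<in> links N" "a \<in> {Alpha1 e, Alpha2 e}"
        using a unfolding arcs_def by blast
      have nn: "0 \<le> h \<tau> d' (Alpha1 e)" "0 \<le> h \<tau> d' (Alpha2 e)" if "d' \<in> requests N" for d'
        using F that \<tau> e arcs_links by (auto simp: feasible_flows_def unit_flow_def)
      have "h \<tau> d (Alpha1 e) + h \<tau> d (Alpha2 e)
          \<le> (\<Sum>d\<in>requests N. h \<tau> d (Alpha1 e) + h \<tau> d (Alpha2 e))"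
        by (rule member_le_sum) (use d finites nn in auto)
      also have "\<dots> \<le> w e" using F \<tau> e by (auto simp: feasible_flows_def)
      finally show ?thesis using w[OF e(1)] nn[OF d] e(2) \<open>k = 0\<close> by auto
    qed
    then have "excess (h \<tau> d) (origin N d) = 0"
      by (simp add: excess_def inflow_def outflow_def)
    then show False
      using F \<tau> d origin_in[OF d] by (auto simp: feasible_flows_def unit_flow_def)
  qed
  have sumk: "(\<Sum>\<kappa>\<in>wavelengths N. y \<tau> d \<kappa> a) = h \<tau> d a"
    if "\<tau> \<in> failing N" "d \<in> requests N" for \<tau> d a
    using k0[OF that] by (simp add: y_def flip: k_def)
  have "feasible_LP_R2 N y w'"
    unfolding feasible_LP_R2_def
  proof (intro conjI ballI)
    fix \<tau> d assume \<tau>: "\<tau> \<in> failing N" and d: "d \<in> requests N"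
    have U: "unit_flow (origin N d) (destination N d) (h \<tau> d)"
      "h \<tau> d (Alpha1 \<tau>) = 0" "h \<tau> d (Alpha2 \<tau>) = 0"
      using F \<tau> d by (auto simp: feasible_flows_def)
    then have ex: "excess (h \<tau> d) (origin N d) = -1" "inflow (h \<tau> d) (origin N d) = 0"
      using origin_in[OF d] by (auto simp: unit_flow_def)
    show "(\<Sum>a\<in>out_arcs N (origin N d). \<Sum>\<kappa>\<in>wavelengths N. y \<tau> d \<kappa> a) = 1"
      "(\<Sum>a\<in>in_arcs N (origin N d). \<Sum>\<kappa>\<in>wavelengths N. y \<tau> d \<kappa> a) = 0"
      using ex by (simp_all add: sumk[OF \<tau> d] sum_in_arcs sum_out_arcs excess_def)
    fix \<kappa> assume \<kappa>: "\<kappa> \<in> wavelengths N"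
    show "y \<tau> d \<kappa> (Alpha1 \<tau>) + y \<tau> d \<kappa> (Alpha2 \<tau>) = 0" using U by (simp add: y_def)
    show "(\<Sum>a\<in>in_arcs N v. y \<tau> d \<kappa> a) = (\<Sum>a\<in>out_arcs N v. y \<tau> d \<kappa> a)"
      if "v \<in> nodes N - {origin N d, destination N d}" for v
    proof -
      have "excess (h \<tau> d) v = 0" using U that by (auto simp: unit_flow_def)
      then show ?thesis
        by (simp add: y_def sum_in_arcs sum_out_arcs excess_def flip: sum_divide_distrib)
    qed
    \<comment> \<open>A positive cardinality is at least 1, so dividing by \<open>k\<close> keeps
      values in the unit interval.\<close>
    have "1 \<le> k" using k[OF \<kappa>] by (simp add: k_def)
    fix a assume "a \<in> arcs N"
    then have "0 \<le> h \<tau> d a" "h \<tau> d a \<le> 1" using U by (auto simp: unit_flow_def)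
    then show "0 \<le> y \<tau> d \<kappa> a" "y \<tau> d \<kappa> a \<le> 1" using \<open>1 \<le> k\<close> by (auto simp: y_def)
  next
    fix \<tau> \<kappa> e assume *: "\<tau> \<in> failing N" "\<kappa> \<in> wavelengths N" "e \<in> links N"
    have "(\<Sum>d\<in>requests N. y \<tau> d \<kappa> (Alpha1 e) + y \<tau> d \<kappa> (Alpha2 e))
        = (\<Sum>d\<in>requests N. h \<tau> d (Alpha1 e) + h \<tau> d (Alpha2 e)) / k"
      by (simp add: y_def sum_divide_distrib add_divide_distrib)
    also have "\<dots> \<le> w' \<kappa> e"
      unfolding w'_def using F * k[OF *(2)]
      by (intro divide_right_mono) (auto simp: feasible_flows_def)
    finally show "(\<Sum>d\<in>requests N. y \<tau> d \<kappa> (Alpha1 e) + y \<tau> d \<kappa> (Alpha2 e)) \<le> w' \<kappa> e" .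
  next
    fix \<kappa> e assume "\<kappa> \<in> wavelengths N" "e \<in> links N"
    then show "0 \<le> w' \<kappa> e" "w' \<kappa> e \<le> 1" using w[of e] k[of \<kappa>] by (auto simp: w'_def)
  qed
  moreover have "objective_LP_R2 N w' = objective_LP_R3 N w"
  \<comment> \<open>For \<open>k = 0\<close> the capacity bounds force \<open>w\<close> to vanish on
    all links, so both objectives are 0.\<close>
  proof (cases "k = 0")
    case True
    then have "w e = 0" if "e \<in> links N" for e using w[OF that] by simp
    then show ?thesis using True by (simp add: objective_LP_R2_def objective_LP_R3_def w'_def)
  next
    case False
    then show ?thesis
      by (simp add: objective_LP_R2_def objective_LP_R3_def w'_def
          flip: k_def sum_divide_distrib)
  qed
  ultimately show ?thesis by blast
qed

section \<open>Between \<open>feasible_LP_R3\<close> and the program without wavelengths\<close>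

text \<open>For each failure and origin \<open>s\<close>, the flow \<open>y \<tau> s\<close> has
  excess \<open>demand N s v\<close> at every other node \<open>v\<close>, which is what
  \<open>decompose_flow\<close> needs to split off one unit flow per request from
  \<open>s\<close>.\<close>

lemma flows_of_LP_R3:
  assumes R3: "feasible_LP_R3 N y w"
  shows "\<exists>h. feasible_flows h w"
proof -
  have "\<exists>g. (\<forall>d\<in>requests_from s. unit_flow s (destination N d) (g d)) \<and>
      (\<forall>a\<in>arcs N. (\<Sum>d\<in>requests_from s. g d a) \<le> y \<tau> s a)"
    if \<tau>: "\<tau> \<in> failing N" and s: "s \<in> nodes N" for \<tau> s
  proof -
    let ?f = "y \<tau> s"
    have bal: "outflow ?f s = (\<Sum>t\<in>nodes N. demand N s t)" "inflow ?f s = 0"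
      using R3 \<tau> s by (auto simp: feasible_LP_R3_def simp flip: sum_in_arcs sum_out_arcs)
    have ex: "excess ?f v = demand N s v" if "v \<in> nodes N - {s}" for v
      using R3 \<tau> s that unfolding feasible_LP_R3_def excess_def
      by (simp flip: sum_in_arcs sum_out_arcs)
    \<comment> \<open>The outflow at \<open>s\<close> counts all requests from \<open>s\<close>,
      including those that end at \<open>s\<close>, whereas the excess at the other nodes accounts
      only for the rest. As the total excess is 0, no request from \<open>s\<close> ends at
      \<open>s\<close>.\<close>
    have "0 = excess ?f s + (\<Sum>v\<in>nodes N - {s}. excess ?f v)"
      using sum_excess_V[of ?f] sum.remove[OF finites(1) s, of "excess ?f"] by simp
    also have "\<dots> = - (\<Sum>t\<in>nodes N. demand N s t) + (\<Sum>v\<in>nodes N - {s}. demand N s v)"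
      using bal ex by (simp add: excess_def)
    also have "\<dots> = - demand N s s"
      using sum.remove[OF finites(1) s, of "demand N s"] by simp
    finally have "\<forall>d\<in>requests_from s. of_bool (s = destination N d) = (0::real)"
      using sum_nonneg_eq_0_iff[OF finite_requests_from,
          of s "\<lambda>d. of_bool (s = destination N d) :: real"]
      by (simp add: demand_sum del: sum_of_bool_eq)
    then have dest: "destination N d \<in> nodes N - {s}" if "d \<in> requests_from s" for d
      using that destination_in by (auto simp: requests_from_def)
    have f0: "0 \<le> ?f a" if "a \<in> arcs N" for a
      using R3 \<tau> s that by (auto simp: feasible_LP_R3_def)
    obtain g where g: "\<forall>d\<in>requests_from s. \<forall>a\<in>arcs N. 0 \<le> g d a \<and> g d a \<le> 1"
      "\<forall>a\<in>arcs N. (\<Sum>d\<in>requests_from s. g d a) \<le> ?f a"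
      "\<forall>d\<in>requests_from s. \<forall>v. excess (g d) v = of_bool (v = destination N d) - of_bool (v = s)"
      using decompose_flow[OF finite_requests_from, of s "destination N" s ?f] dest f0 ex
      by (auto simp: demand_sum)
    have "unit_flow s (destination N d) (g d)" if d: "d \<in> requests_from s" for d
    proof (rule unit_flow_below[OF bal(2)])
      have "g d a \<le> ?f a" if "a \<in> arcs N" for a
      proof -
        have "g d a \<le> (\<Sum>d\<in>requests_from s. g d a)"
          by (rule member_le_sum[OF d _ finite_requests_from]) (use g that in auto)
        then show ?thesis using g that by force
      qed
      then show "\<forall>a\<in>arcs N. 0 \<le> g d a \<and> g d a \<le> ?f a \<and> g d a \<le> 1" using g d by auto
    qed (use g d dest[OF d] in auto)
    then show ?thesis using g by blast
  qed
  then have "\<forall>\<tau>\<in>failing N. \<forall>s\<in>nodes N. \<exists>g.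
      (\<forall>d\<in>requests_from s. unit_flow s (destination N d) (g d)) \<and>
      (\<forall>a\<in>arcs N. (\<Sum>d\<in>requests_from s. g d a) \<le> y \<tau> s a)" by blast
  then obtain g where g: "\<And>\<tau> s. \<tau> \<in> failing N \<Longrightarrow> s \<in> nodes N \<Longrightarrow>
      (\<forall>d\<in>requests_from s. unit_flow s (destination N d) (g \<tau> s d)) \<and>
      (\<forall>a\<in>arcs N. (\<Sum>d\<in>requests_from s. g \<tau> s d a) \<le> y \<tau> s a)"
    by metis
  \<comment> \<open>Each request takes its flow from the decomposition belonging to its own
    origin.\<close>
  define h where "h \<tau> d = g \<tau> (origin N d) d" for \<tau> d
  have U: "unit_flow (origin N d) (destination N d) (h \<tau> d)"
    if "\<tau> \<in> failing N" "d \<in> requests N" for \<tau> d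
    using g[OF that(1) origin_in[OF that(2)]] that by (auto simp: h_def requests_from_def)
  have le: "(\<Sum>d\<in>requests_from s. h \<tau> d a) \<le> y \<tau> s a"
    if "\<tau> \<in> failing N" "s \<in> nodes N" "a \<in> arcs N" for \<tau> s a
  proof -
    have "(\<Sum>d\<in>requests_from s. h \<tau> d a) = (\<Sum>d\<in>requests_from s. g \<tau> s d a)"
      by (rule sum.cong) (auto simp: h_def requests_from_def)
    then show ?thesis using g that by auto
  qed
  have "h \<tau> d (Alpha1 \<tau>) = 0 \<and> h \<tau> d (Alpha2 \<tau>) = 0"
    if \<tau>: "\<tau> \<in> failing N" and d: "d \<in> requests N" for \<tau> d
  proof -
    let ?s = "origin N d"
    have d': "d \<in> requests_from ?s" using d by (simp add: requests_from_def)
    have s: "?s \<in> nodes N" using origin_in[OF d] .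
    have a: "Alpha1 \<tau> \<in> arcs N" "Alpha2 \<tau> \<in> arcs N"
      using arcs_links failing_links[OF \<tau>] by auto
    have hy: "0 \<le> h \<tau> d a \<and> h \<tau> d a \<le> y \<tau> ?s a" if "a \<in> arcs N" for a
    proof -
      have "h \<tau> d a \<le> (\<Sum>d\<in>requests_from ?s. h \<tau> d a)"
        by (rule member_le_sum[OF d' _ finite_requests_from])
          (use U[OF \<tau>] that in \<open>auto simp: unit_flow_def requests_from_def\<close>)
      then show ?thesis
        using le[OF \<tau> s that] U[OF \<tau> d] that by (auto simp: unit_flow_def)
    qed
    have "y \<tau> ?s (Alpha1 \<tau>) + y \<tau> ?s (Alpha2 \<tau>) = 0"
      using R3 \<tau> s by (auto simp: feasible_LP_R3_def)
    then show ?thesis using hy[OF a(1)] hy[OF a(2)] by linarith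
  qed
  moreover have "(\<Sum>d\<in>requests N. h \<tau> d (Alpha1 e) + h \<tau> d (Alpha2 e)) \<le> w e"
    if \<tau>: "\<tau> \<in> failing N" and e: "e \<in> links N" for \<tau> e
  proof -
    have "(\<Sum>d\<in>requests N. h \<tau> d (Alpha1 e) + h \<tau> d (Alpha2 e))
        = (\<Sum>s\<in>nodes N. \<Sum>d\<in>requests_from s. h \<tau> d (Alpha1 e) + h \<tau> d (Alpha2 e))"
      by (rule sum_requests[symmetric])
    also have "\<dots> \<le> (\<Sum>s\<in>nodes N. y \<tau> s (Alpha1 e) + y \<tau> s (Alpha2 e))"
      unfolding sum.distrib using le[OF \<tau>] arcs_links e by (intro add_mono sum_mono) auto
    also have "\<dots> \<le> w e" using R3 \<tau> e by (auto simp: feasible_LP_R3_def)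
    finally show ?thesis .
  qed
  moreover have "0 \<le> w e \<and> w e \<le> real (card (wavelengths N))" if "e \<in> links N" for e
    using R3 that by (auto simp: feasible_LP_R3_def)
  ultimately show ?thesis using U unfolding feasible_flows_def by (intro exI[of _ h]) auto
qed

text \<open>Unit flows with a common origin are added; the capacities \<open>w\<close> stay the
  same, since summing over origins and then over their requests runs through every request
  once.\<close>

lemma LP_R3_of_flows:
  assumes F: "feasible_flows h w"
  shows "\<exists>y. feasible_LP_R3 N y w"
proof -
  define y where "y \<tau> s = (\<lambda>a. \<Sum>d\<in>requests_from s. h \<tau> d a)" for \<tau> s
  have U: "unit_flow s (destination N d) (h \<tau> d)" "h \<tau> d (Alpha1 \<tau>) = 0" "h \<tau> d (Alpha2 \<tau>) = 0"
    if "\<tau> \<in> failing N" "d \<in> requests_from s" for \<tau> d s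
    using F that by (auto simp: feasible_flows_def requests_from_def)
  have "feasible_LP_R3 N y w"
    unfolding feasible_LP_R3_def
  proof (intro conjI ballI)
    fix \<tau> s assume \<tau>: "\<tau> \<in> failing N" and s: "s \<in> nodes N"
    have i: "inflow (y \<tau> s) s = 0"
      unfolding y_def inflow_sum using U[OF \<tau>] by (simp add: unit_flow_def)
    then show "(\<Sum>a\<in>in_arcs N s. y \<tau> s a) = 0" by (simp add: sum_in_arcs)
    have ex: "excess (y \<tau> s) v = demand N s v - real (card (requests_from s)) * of_bool (v = s)"
      if "v \<in> nodes N" for v
      unfolding y_def excess_sum demand_sum using U(1)[OF \<tau>] that
      by (simp add: unit_flow_def sum_subtractf)
    \<comment> \<open>Unit flows have distinct ends, so no request from \<open>s\<close> ends at
      \<open>s\<close>; the excess at \<open>s\<close> is therefore the full negative number of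
      requests.\<close>
    have "demand N s s = 0"
      unfolding demand_sum using U(1)[OF \<tau>] by (intro sum.neutral) (auto simp: unit_flow_def)
    then show "(\<Sum>a\<in>out_arcs N s. y \<tau> s a) = (\<Sum>t\<in>nodes N. demand N s t)"
      using ex[OF s] i by (simp add: sum_out_arcs excess_def total_demand)
    show "(\<Sum>a\<in>in_arcs N v. y \<tau> s a) = (\<Sum>a\<in>out_arcs N v. y \<tau> s a) + demand N s v"
      if "v \<in> nodes N - {s}" for v
      using ex[of v] that by (simp add: sum_in_arcs sum_out_arcs excess_def)
    show "y \<tau> s (Alpha1 \<tau>) + y \<tau> s (Alpha2 \<tau>) = 0" using U[OF \<tau>] by (simp add: y_def)
    fix a assume a: "a \<in> arcs N"
    show "0 \<le> y \<tau> s a"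
      unfolding y_def using U(1)[OF \<tau>] a by (intro sum_nonneg) (auto simp: unit_flow_def)
    \<comment> \<open>The bound 1 on unit flows is what yields the upper bound on the variables of
      this program.\<close>
    have "y \<tau> s a \<le> (\<Sum>d\<in>requests_from s. 1)"
      unfolding y_def using U(1)[OF \<tau>] a by (intro sum_mono) (auto simp: unit_flow_def)
    then show "y \<tau> s a \<le> (\<Sum>t\<in>nodes N. demand N s t)" by (simp add: total_demand)
  next
    fix \<tau> e assume "\<tau> \<in> failing N" "e \<in> links N"
    moreover have "(\<Sum>s\<in>nodes N. y \<tau> s (Alpha1 e) + y \<tau> s (Alpha2 e))
        = (\<Sum>d\<in>requests N. h \<tau> d (Alpha1 e) + h \<tau> d (Alpha2 e))"
      unfolding y_def sum.distrib[symmetric] by (rule sum_requests)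
    ultimately show "(\<Sum>s\<in>nodes N. y \<tau> s (Alpha1 e) + y \<tau> s (Alpha2 e)) \<le> w e"
      using F by (auto simp: feasible_flows_def)
  qed (use F in \<open>auto simp: feasible_flows_def\<close>)
  then show ?thesis by blast
qed

section \<open>Equality of the optimal values\<close>

text \<open>Every attainable value transfers in both directions through the program without
  wavelengths. Equality of the value sets, rather than of their infima, makes attainment irrelevant
  and covers infeasibility, where both sets are empty.\<close>

lemma objective_values_eq:
  "{ereal (objective_LP_R3 N w) | y w. feasible_LP_R3 N y w}
     = {ereal (objective_LP_R2 N w) | y w. feasible_LP_R2 N y w}" (is "?R3 = ?R2")
proof
  show "?R3 \<subseteq> ?R2"
  proof
    fix z assume "z \<in> ?R3"
    then obtain y w where z: "z = ereal (objective_LP_R3 N w)" and "feasible_LP_R3 N y w" by blast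
    then obtain h where "feasible_flows h w" using flows_of_LP_R3 by blast
    then obtain y' w' where "feasible_LP_R2 N y' w'" "objective_LP_R2 N w' = objective_LP_R3 N w"
      using LP_R2_of_flows by blast
    then show "z \<in> ?R2" using z by (metis (mono_tags, lifting) mem_Collect_eq)
  qed
  show "?R2 \<subseteq> ?R3"
  proof
    fix z assume "z \<in> ?R2"
    then obtain y w where z: "z = ereal (objective_LP_R2 N w)" and R2: "feasible_LP_R2 N y w" by blast
    define w' where "w' e = (\<Sum>\<kappa>\<in>wavelengths N. w \<kappa> e)" for e
    obtain h where "feasible_flows h w'" using flows_of_LP_R2[OF R2] by (auto simp: w'_def[abs_def])
    then obtain y' where "feasible_LP_R3 N y' w'" using LP_R3_of_flows by blast
    moreover have "objective_LP_R2 N w = objective_LP_R3 N w'"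
      unfolding objective_LP_R2_def objective_LP_R3_def w'_def by (rule sum.swap)
    ultimately show "z \<in> ?R3" using z by blast
  qed
qed

end

theorem proposition3:
  fixes N :: "('v, 'e, 'k, 'd) network"
  assumes "valid_instance N"
  shows "z_LP_R3 N = z_LP_R2 N"
proof -
  interpret valid_network N by unfold_locales (rule assms)
  show ?thesis unfolding z_LP_R3_def z_LP_R2_def by (simp only: objective_values_eq)
qed

end
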